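(* Fix a trade size $\Delta x>0$ and a marginal price $P>0$. Then the slippage function $L\mapsto S(L)$, $L\in(0,\infty)$, of a constant product pool is strictly convex in the liquidity depth $L$, and the marginal utility of expanding liquidity, i.e. the marginal slippage reduction $\left|\frac{dS}{dL}(L)\right|$, is strictly decreasing in $L$ and tends to $0$ as $L\to\infty$.
   Context: A constant product pool with liquidity $L>0$ and marginal price $P>0$ has reserves $x=L/\sqrt{P}$, $y=L\sqrt{P}$ (so $xy=L^2$ and $y/x=P$). A (fee-free) trade of size $\Delta x>0$ pays out $\Delta y$ where $(x+\Delta x)(y-\Delta y)=L^2$. The effective price is $P_{eff}=\Delta y/\Delta x$, and the slippage is $$S(L)=\frac{P-P_{eff}}{P}=\frac{\Delta x}{x+\Delta x},\qquad x=\frac{L}{\sqrt P}.$$ *)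

theory Defs
  imports "HOL-Analysis.Analysis"
begin

text \<open>Strict version of \<^const>\<open>convex_on\<close>.\<close>

definition strictly_convex_on :: "'a::real_vector set \<Rightarrow> ('a \<Rightarrow> real) \<Rightarrow> bool"
  where "strictly_convex_on S f \<longleftrightarrow> convex S \<and>
    (\<forall>x\<in>S. \<forall>y\<in>S. \<forall>u>0. \<forall>v>0. x \<noteq> y \<and> u + v = 1 \<longrightarrow>
      f (u *\<^sub>R x + v *\<^sub>R y) < u * f x + v * f y)"

definition reserve_x :: "real \<Rightarrow> real \<Rightarrow> real"
  where "reserve_x P L = L / sqrt P"

definition reserve_y :: "real \<Rightarrow> real \<Rightarrow> real"
  where "reserve_y P L = L * sqrt P"

lemma reserves_product: "P > 0 \<Longrightarrow> reserve_x P L * reserve_y P L = L\<^sup>2"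
  by (simp add: reserve_x_def reserve_y_def power2_eq_square)

lemma reserves_ratio: "P > 0 \<Longrightarrow> L > 0 \<Longrightarrow> reserve_y P L / reserve_x P L = P"
  by (simp add: reserve_x_def reserve_y_def)

text \<open>The payout of a trade of size \<open>dx\<close> is determined by invariance of the reserve product;
  see \<open>trade_payout_unique\<close> for existence and uniqueness.\<close>

definition trade_payout :: "real \<Rightarrow> real \<Rightarrow> real \<Rightarrow> real"
  where "trade_payout dx P L =
    (THE dy. (reserve_x P L + dx) * (reserve_y P L - dy) = L\<^sup>2)"

definition effective_price :: "real \<Rightarrow> real \<Rightarrow> real \<Rightarrow> real"
  where "effective_price dx P L = trade_payout dx P L / dx"

definition slippage :: "real \<Rightarrow> real \<Rightarrow> real \<Rightarrow> real"
  where "slippage dx P L = (P - effective_price dx P L) / P"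

lemma trade_payout_unique:
  assumes "dx > 0" "P > 0" "L > 0"
  shows "\<exists>!dy. (reserve_x P L + dx) * (reserve_y P L - dy) = L\<^sup>2"
proof -
  have "reserve_x P L + dx > 0"
    using assms by (simp add: reserve_x_def add_pos_pos)
  then have "(reserve_x P L + dx) * (reserve_y P L - dy) = L\<^sup>2
      \<longleftrightarrow> dy = reserve_y P L - L\<^sup>2 / (reserve_x P L + dx)" for dy
    by (auto simp: field_simps)
  then show ?thesis by simp
qed

lemma slippage_eq:
  assumes "dx > 0" "P > 0" "L > 0"
  shows "slippage dx P L = dx / (reserve_x P L + dx)"
proof -
  define x where "x = reserve_x P L"
  have x: "x > 0" using assms by (simp add: x_def reserve_x_def)
  have L: "L = x * sqrt P"
    using assms by (simp add: x_def reserve_x_def)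
  then have y: "reserve_y P L = P * x" and L2: "L\<^sup>2 = P * x\<^sup>2"
    using assms by (simp_all add: reserve_y_def power_mult_distrib)
  have "(x + dx) * (P * x - P * x * dx / (x + dx)) = L\<^sup>2"
    using x assms unfolding L2 by (simp add: field_simps power2_eq_square)
  then have "trade_payout dx P L = P * x * dx / (x + dx)"
    unfolding trade_payout_def
    using trade_payout_unique[OF assms] by (intro the1_equality) (simp_all add: y flip: x_def)
  then show ?thesis
    using x assms unfolding slippage_def effective_price_def x_def[symmetric]
    by (simp add: field_simps)
qed

end

theory Submission
  imports Defs "HOL-Real_Asymp.Real_Asymp"
begin

text \<open>Clearing \<open>sqrt P\<close> gives \<open>S(L) = c / (L + c)\<close> with \<open>c = dx * sqrt P\<close>, a shifted
  reciprocal, whose derivative is \<open>- c / (L + c)\<^sup>2\<close>.\<close>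

text \<open>Over a common denominator the right side is \<open>(u * y + v * x) / (x * y)\<close>.
  Cross-multiplying by positive quantities turns the gap into
  \<open>u * v * (x - y)\<^sup>2\<close>, which is positive for distinct points and positive
  weights.\<close>

lemma inverse_strictly_convex:
  fixes x y u v :: real
  assumes "x > 0" "y > 0" "x \<noteq> y" "u > 0" "v > 0" "u + v = 1"
  shows "1 / (u * x + v * y) < u / x + v / y"
proof -
  have pos: "u * x + v * y > 0"
    using assms by (simp add: add_pos_pos)
  have v: "v = 1 - u"
    using assms by simp
  \<comment> \<open>Since u + v = 1, the coefficient of \<open>x * y\<close> is u^2 + v^2 - 1 =
    -2uv, which completes the square.\<close>
  have "(u * y + v * x) * (u * x + v * y) - x * y = u * v * (x - y)\<^sup>2"
    unfolding v by (simp add: power2_eq_square algebra_simps)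
  moreover have "u * v * (x - y)\<^sup>2 > 0"
    using assms by simp
  ultimately have "x * y < (u * y + v * x) * (u * x + v * y)"
    by linarith
  then have "1 / (u * x + v * y) < (u * y + v * x) / (x * y)"
    using assms pos by (simp add: divide_less_eq less_divide_eq mult.commute)
  also have "\<dots> = u / x + v / y"
    using assms by (simp add: field_simps)
  finally show ?thesis .
qed

lemma slippage_eq_shifted_reciprocal:
  assumes "dx > 0" "P > 0" "L > 0"
  shows "slippage dx P L = dx * sqrt P / (L + dx * sqrt P)"
  using assms by (simp add: slippage_eq reserve_x_def field_simps)

lemma slippage_has_real_derivative:
  assumes "dx > 0" "P > 0" "L > 0"
  shows "(slippage dx P has_real_derivative - (dx * sqrt P) / (L + dx * sqrt P)\<^sup>2) (at L)"
proof -
  define c where "c = dx * sqrt P"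
  have c: "c > 0"
    using assms by (simp add: c_def)
  have "((\<lambda>L. c / (L + c)) has_real_derivative - c / (L + c)\<^sup>2) (at L)"
    using c assms by (auto intro!: derivative_eq_intros simp: power2_eq_square)
  then have "(slippage dx P has_real_derivative - c / (L + c)\<^sup>2) (at L)"
    \<comment> \<open>The closed form is available only for positive arguments; the open set
      \<open>{0<..}\<close> is a neighbourhood of \<open>L\<close> on which both functions agree,
      and this suffices for equal derivatives.\<close>
    by (rule DERIV_cong_ev[THEN iffD1, rotated -1])
      (use assms eventually_nhds_in_open[of "{0<..}" L] in
        \<open>auto elim!: eventually_mono simp: slippage_eq_shifted_reciprocal c_def\<close>)
  then show ?thesis
    by (simp add: c_def)
qed

lemma strictly_convex_on_slippage:
  assumes "dx > 0" "P > 0"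
  shows "strictly_convex_on {0<..} (slippage dx P)"
  unfolding strictly_convex_on_def
proof (intro conjI ballI allI impI)
  show "convex {0::real<..}"
    by (simp add: convex_real_interval)
next
  fix x y u v :: real
  assume xy: "x \<in> {0<..}" "y \<in> {0<..}" and uv: "u > 0" "v > 0" "x \<noteq> y \<and> u + v = 1"
  define c where "c = dx * sqrt P"
  have c: "c > 0"
    using assms by (simp add: c_def)
  have S: "slippage dx P L = c / (L + c)" if "L > 0" for L
    using assms that by (simp add: slippage_eq_shifted_reciprocal c_def)
  have pos: "u * x + v * y > 0"
    using xy uv by (simp add: add_pos_pos)
  \<comment> \<open>Weights summing to 1 make the shift by \<open>c\<close> commute with the convex
    combination, so convexity of the reciprocal applies at the shifted points.\<close>
  have "u * (x + c) + v * (y + c) = u * x + v * y + (u + v) * c"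
    by (simp add: algebra_simps)
  then have "u * (x + c) + v * (y + c) = u * x + v * y + c"
    using uv by simp
  then have "1 / (u * x + v * y + c) < u / (x + c) + v / (y + c)"
    using inverse_strictly_convex[of "x + c" "y + c" u v] xy uv c by simp
  then have "c * (1 / (u * x + v * y + c)) < c * (u / (x + c) + v / (y + c))"
    using c by (rule mult_strict_left_mono)
  then show "slippage dx P (u *\<^sub>R x + v *\<^sub>R y) < u * slippage dx P x + v * slippage dx P y"
    using xy pos by (simp add: S distrib_left mult.commute)
qed

theorem lemma4:
  fixes dx P :: real
  assumes "dx > 0" and "P > 0"
  shows "strictly_convex_on {0<..} (slippage dx P)
    \<and> (\<forall>L>0. slippage dx P differentiable (at L))
    \<and> strict_antimono_on {0<..} (\<lambda>L. \<bar>deriv (slippage dx P) L\<bar>)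
    \<and> ((\<lambda>L. \<bar>deriv (slippage dx P) L\<bar>) \<longlongrightarrow> 0) at_top"
proof (intro conjI allI impI)
  define c where "c = dx * sqrt P"
  have c: "c > 0"
    using assms by (simp add: c_def)
  have abs_deriv: "\<bar>deriv (slippage dx P) L\<bar> = c / (L + c)\<^sup>2" if "L > 0" for L
    using DERIV_imp_deriv[OF slippage_has_real_derivative[OF assms that]] c
    by (simp add: c_def)
  show "strictly_convex_on {0<..} (slippage dx P)"
    using assms by (rule strictly_convex_on_slippage)
  \<comment> \<open>This conjunct gives \<open>deriv\<close> its meaning: \<open>deriv\<close> is a
    choice operator, arbitrary where no derivative exists.\<close>
  show "slippage dx P differentiable (at L)" if "L > 0" for L
    using slippage_has_real_derivative[OF assms that] unfolding real_differentiable_def by blast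
  show "strict_antimono_on {0<..} (\<lambda>L. \<bar>deriv (slippage dx P) L\<bar>)"
  proof (rule monotone_onI)
    fix L M :: real
    assume "L \<in> {0<..}" "M \<in> {0<..}" "L < M"
    \<comment> \<open>The numerator \<open>c\<close> is fixed and positive, while the square of the
      positive number \<open>L + c\<close> grows with \<open>L\<close>.\<close>
    then show "\<bar>deriv (slippage dx P) M\<bar> < \<bar>deriv (slippage dx P) L\<bar>"
      using c by (auto simp: abs_deriv intro!: divide_strict_left_mono power_strict_mono)
  qed
  have "((\<lambda>L. c / (L + c)\<^sup>2) \<longlongrightarrow> 0) at_top"
    by real_asymp
  \<comment> \<open>A limit at infinity sees only large \<open>L\<close>, so the formula for
    positive \<open>L\<close> is enough.\<close>
  moreover have "\<forall>\<^sub>F L in at_top. c / (L + c)\<^sup>2 = \<bar>deriv (slippage dx P) L\<bar>"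
    using eventually_gt_at_top[of "0::real"] by eventually_elim (simp add: abs_deriv)
  ultimately show "((\<lambda>L. \<bar>deriv (slippage dx P) L\<bar>) \<longlongrightarrow> 0) at_top"
    by (rule Lim_transform_eventually)
qed

end
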